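(* Let $r\in\mathbb{C}\setminus\{0,1,\tfrac12,\tfrac13\}$ be not of the form $-1/m$ with $m$ a positive integer. For a nonempty subset $A\subseteq\{0,1,2,3,4\}$ let $\mathcal{C}_r(A)$ be the set of all $\alpha(\cdot,r)\in\mathcal{C}_r$ such that, for $k\in\{0,1,2,3,4\}$, the coefficient $d_k$ in the partial fractions decomposition of $\alpha(\cdot,r)$ is nonzero if and only if $k\in A$. Then: (i) $\mathcal{C}_r(A)\cap\mathcal{C}_r(B)=\emptyset$ whenever $A\neq B$. (ii) $\mathcal{C}_r(A)$ is nonempty for exactly 19 nonempty subsets $A$ of $\{0,1,2,3,4\}$, namely $$\{0,1,2,3,4\},$$ $$\{1,2,3,4\},\ \{0,2,3,4\},\ \{0,1,3,4\},\ \{0,1,2,4\},\ \{0,1,2,3\},$$ $$\{2,3,4\},\ \{1,3,4\},\ \{1,2,4\},\ \{1,2,3\},\ \{0,3,4\},\ \{0,2,4\},\ \{0,2,3\},$$ $$\{3,4\},\ \{2,4\},\ \{2,3\},\ \{0,1\},\ \{0\},\ \{1\}.$$ (iii) $\mathcal{C}_r(\{0\})\cup\mathcal{C}_r(\{1\})\cup\mathcal{C}_r(\{0,1\})\subseteq\mathcal{C}_0$.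
   Context: Parameters: $v=(b_0,b_1,b_2,s_1,s_2)\in\mathbb{C}^5$ and $r\in\mathbb{C}$. Put $x_k=b_0+b_1k+b_2k(k-1)$ and $$\gamma(n,m,r)=\frac{(n-m+1)\bigl((nr-mr+1)x_{n-m}+(n-m)s_2+s_1\bigr)}{(2n-m-1)r+1},$$ $$\alpha(n,r)=\gamma(n,1,r)\Bigl(\tfrac12\bigl(\gamma(n,0,r)-2\gamma(n,1,r)+\gamma(n,2,r)\bigr)-(x_n-x_{n-1})\Bigr),$$ regarded as rational functions of $n$. (These $\alpha(n,r)$ are the coefficients in the three-term recurrence relations of the hypergeometric orthogonal polynomial sequences.) For $r\neq0$, $\mathcal{C}_r$ is the set of all rational functions $\alpha(\cdot,r)$ of $n$ obtained from parameter vectors $v$ with $(s_1+b_0)(s_2-rs_1)\neq0$ (equivalently $\alpha(1,r)\ne 0$). $\mathcal{C}_0$ is the set of all not identically zero polynomials in $n$ of the form $$\alpha(n,0)=n\bigl((n-1)b_2+s_2\bigr)\bigl((n^2-3n+2)b_2+(n-1)(b_1+s_2)+b_0+s_1\bigr),\qquad v\in\mathbb{C}^5 .$$ Partial fractions decomposition: for $r\ne0$, $$\alpha(n,r)=\frac{1}{256r^6}\,(d_0y_0+d_1y_1+d_2y_2+d_3y_3+d_4y_4),$$ where $$y_0=(4r^2n)^2(nr-2r+1)^2,\quad y_1=4r^3n(nr-2r+1),\quad y_2=1,$$ $$y_3=\frac{(r-1)(3r-1)}{(2nr-r+1)(2nr-3r+1)},\quad y_4=\frac{-(2r-1)^2}{(2nr-2r+1)^2},$$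 and $d_0=b_2^2$, $d_1=p_1$, $d_3=p_2p_3$, $d_4=p_4^2$, $d_2=d_4-d_3$, with $$p_1=\bigl(b_2^2+8b_2(b_0+b_1)-4b_1^2\bigr)r^2+4b_2(2s_2+b_1-2b_2)r-2b_2^2,$$ $$p_2=(4b_0+2b_1-b_2)r^3+(8s_1+4s_2+4b_0-b_2)r^2+(b_2-4s_2-2b_1)r+b_2,$$ $$p_3=(2b_1-4b_0-3b_2)r^3+(8s_1-4s_2+4b_0-b_2)r^2+(3b_2-4s_2-2b_1)r+b_2,$$ $$p_4=(8s_1+4b_0)r^2+(2b_2-4s_2-2b_1)r+b_2.$$ For $r\notin\{0,1,\frac12,\frac13\}$ the functions $y_0,\dots,y_4$ of $n$ are linearly independent, so the $d_k$ are determined by the function $\alpha(\cdot,r)$. *)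

theory Defs
  imports Complex_Main "HOL-Computational_Algebra.Computational_Algebra"
begin

(* Rational functions of n are elements of the field C(n), so that equality is equality of
   rational functions and no values at poles have to be chosen. *)

type_synonym ratfun = "complex poly fract"

definition rconst :: "complex \<Rightarrow> ratfun" where
  "rconst c = to_fract [:c:]"

definition nvar :: ratfun where
  "nvar = to_fract [:0, 1:]"

record params =
  b0 :: complex
  b1 :: complex
  b2 :: complex
  s1 :: complex
  s2 :: complex

definition xseq :: "params \<Rightarrow> ratfun \<Rightarrow> ratfun" where
  "xseq v k = rconst (b0 v) + rconst (b1 v) * k + rconst (b2 v) * k * (k - 1)"

definition gam :: "params \<Rightarrow> ratfun \<Rightarrow> ratfun \<Rightarrow> complex \<Rightarrow> ratfun" where
  "gam v n m r =
     (n - m + 1) * ((n * rconst r - m * rconst r + 1) * xseq v (n - m)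
        + (n - m) * rconst (s2 v) + rconst (s1 v))
     / ((2 * n - m - 1) * rconst r + 1)"

definition alpha :: "params \<Rightarrow> complex \<Rightarrow> ratfun" where
  "alpha v r =
     gam v nvar 1 r *
       (1/2 * (gam v nvar 0 r - 2 * gam v nvar 1 r + gam v nvar 2 r)
        - (xseq v nvar - xseq v (nvar - 1)))"

definition alpha_zero :: "params \<Rightarrow> complex poly" where
  "alpha_zero v = (let n = [:0, 1:] in
     n * ((n - 1) * [:b2 v:] + [:s2 v:]) *
       ((n^2 - 3 * n + 2) * [:b2 v:] + (n - 1) * [:b1 v + s2 v:] + [:b0 v + s1 v:]))"

definition C_fam :: "complex \<Rightarrow> ratfun set" where
  "C_fam r =
     (if r = 0 then {to_fract (alpha_zero v) | v. alpha_zero v \<noteq> 0}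
      else {alpha v r | v. (s1 v + b0 v) * (s2 v - r * s1 v) \<noteq> 0})"

definition y_fun :: "complex \<Rightarrow> nat \<Rightarrow> ratfun" where
  "y_fun r k = (let n = nvar; q = rconst r in
     [ (4 * q^2 * n)^2 * (n * q - 2 * q + 1)^2,
       4 * q^3 * n * (n * q - 2 * q + 1),
       1,
       (q - 1) * (3 * q - 1) / ((2 * n * q - q + 1) * (2 * n * q - 3 * q + 1)),
       - ((2 * q - 1)^2) / (2 * n * q - 2 * q + 1)^2 ] ! k)"

definition pf_decomp :: "complex \<Rightarrow> ratfun \<Rightarrow> (nat \<Rightarrow> complex) \<Rightarrow> bool" where
  "pf_decomp r f d \<longleftrightarrow>
     f = rconst (1 / (256 * r^6)) * (\<Sum>k\<in>{0..4}. rconst (d k) * y_fun r k)"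

definition p1 :: "params \<Rightarrow> complex \<Rightarrow> complex" where
  "p1 v r = (b2 v^2 + 8 * b2 v * (b0 v + b1 v) - 4 * b1 v^2) * r^2
     + 4 * b2 v * (2 * s2 v + b1 v - 2 * b2 v) * r - 2 * b2 v^2"

definition p2 :: "params \<Rightarrow> complex \<Rightarrow> complex" where
  "p2 v r = (4 * b0 v + 2 * b1 v - b2 v) * r^3
     + (8 * s1 v + 4 * s2 v + 4 * b0 v - b2 v) * r^2
     + (b2 v - 4 * s2 v - 2 * b1 v) * r + b2 v"

definition p3 :: "params \<Rightarrow> complex \<Rightarrow> complex" where
  "p3 v r = (2 * b1 v - 4 * b0 v - 3 * b2 v) * r^3
     + (8 * s1 v - 4 * s2 v + 4 * b0 v - b2 v) * r^2
     + (3 * b2 v - 4 * s2 v - 2 * b1 v) * r + b2 v"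

definition p4 :: "params \<Rightarrow> complex \<Rightarrow> complex" where
  "p4 v r = (8 * s1 v + 4 * b0 v) * r^2 + (2 * b2 v - 4 * s2 v - 2 * b1 v) * r + b2 v"

definition d_coeff :: "params \<Rightarrow> complex \<Rightarrow> nat \<Rightarrow> complex" where
  "d_coeff v r k =
     [ b2 v^2, p1 v r, p4 v r^2 - p2 v r * p3 v r, p2 v r * p3 v r, p4 v r^2 ] ! k"

lemma rconst_hom:
  "rconst 0 = 0" "rconst 1 = 1" "rconst (numeral w) = numeral w"
  "rconst (a + b) = rconst a + rconst b" "rconst (a - b) = rconst a - rconst b"
  "rconst (a * b) = rconst a * rconst b" "rconst (a ^ k) = rconst a ^ k"
proof -
  show *: "rconst 0 = 0" "rconst 1 = 1" "rconst (a + b) = rconst a + rconst b"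
    "rconst (a - b) = rconst a - rconst b" "rconst (a * b) = rconst a * rconst b" for a b
    by (simp_all add: rconst_def flip: to_fract_add to_fract_diff to_fract_mult one_pCons)
  have "rconst (of_nat j) = of_nat j" for j
    by (induction j) (simp_all add: *)
  from this[of "numeral w"] show "rconst (numeral w) = numeral w" by simp
  show "rconst (a ^ k) = rconst a ^ k" by (induction k) (simp_all add: *)
qed

lemma decomp_identity:
  fixes n q B0 B1 B2 S1 S2 :: "'a :: field"
  assumes two: "(2::'a) \<noteq> 0"
    and D: "(2*n-1)*q+1 \<noteq> 0" "(2*n-2)*q+1 \<noteq> 0" "(2*n-3)*q+1 \<noteq> 0"
  defines "x \<equiv> \<lambda>k. B0 + B1*k + B2*k*(k-1)"
  defines "g \<equiv> \<lambda>m. (n-m+1)*((n*q-m*q+1)*x (n-m)+(n-m)*S2+S1)/((2*n-m-1)*q+1)"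
  defines "P1 \<equiv> (B2^2+8*B2*(B0+B1)-4*B1^2)*q^2+4*B2*(2*S2+B1-2*B2)*q-2*B2^2"
    and "P2 \<equiv> (4*B0+2*B1-B2)*q^3+(8*S1+4*S2+4*B0-B2)*q^2+(B2-4*S2-2*B1)*q+B2"
    and "P3 \<equiv> (2*B1-4*B0-3*B2)*q^3+(8*S1-4*S2+4*B0-B2)*q^2+(3*B2-4*S2-2*B1)*q+B2"
    and "P4 \<equiv> (8*S1+4*B0)*q^2+(2*B2-4*S2-2*B1)*q+B2"
  shows "256*q^6*(g 1*(1/2*(g 0-2*g 1+g 2)-(x n-x (n-1)))) =
    B2^2*((4*q^2*n)^2*(n*q-2*q+1)^2) + P1*(4*q^3*n*(n*q-2*q+1)) + (P4^2-P2*P3)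
    + P2*P3*((q-1)*(3*q-1)/((2*n*q-q+1)*(2*n*q-3*q+1)))
    + P4^2*(-((2*q-1)^2)/(2*n*q-2*q+1)^2)"
proof -
  define u where "u = 2*n*q-2*q+1"
  have u: "u \<noteq> 0" "u + q \<noteq> 0" "u - q \<noteq> 0" using D by (simp_all add: u_def algebra_simps)
  define N0 where "N0 = (n+1)*((n*q+1)*x n+n*S2+S1)"
  define N1 where "N1 = n*(((n-1)*q+1)*x (n-1)+(n-1)*S2+S1)"
  define N2 where "N2 = (n-1)*(((n-2)*q+1)*x (n-2)+(n-2)*S2+S1)"
  have g: "g 0 = N0/(u+q)" "g 1 = N1/u" "g 2 = N2/(u-q)"
    by (simp_all add: g_def N0_def N1_def N2_def u_def algebra_simps)
  have e: "2*n*q-q+1 = u+q" "2*n*q-3*q+1 = u-q" "2*n*q-2*q+1 = u"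
    by (simp_all add: u_def algebra_simps)
  have main: "256*q^6*N1*(N0*u*(u-q)-2*N1*(u+q)*(u-q)+N2*u*(u+q)-2*(x n-x (n-1))*u*(u+q)*(u-q)) =
     2*((B2^2*((4*q^2*n)^2*(n*q-2*q+1)^2) + P1*(4*q^3*n*(n*q-2*q+1)) + (P4^2-P2*P3))*u^2*(u+q)*(u-q)
      + P2*P3*((q-1)*(3*q-1))*u^2 - P4^2*(2*q-1)^2*((u+q)*(u-q)))"
    unfolding N0_def N1_def N2_def x_def P1_def P2_def P3_def P4_def u_def by algebra
  show ?thesis unfolding g e using two u main
    by (simp add: divide_simps) algebra
qed

lemma affine_nonzero:
  assumes "r \<noteq> 0"
  shows "(2 * nvar - rconst c) * rconst r + 1 \<noteq> 0"
proof -
  have "rconst 2 = 2" by (simp add: rconst_hom)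
  hence "(2 * nvar - rconst c) * rconst r + 1 = to_fract (([:2:] * [:0, 1:] - [:c:]) * [:r:] + 1)"
    unfolding to_fract_add to_fract_diff to_fract_mult to_fract_1
    by (simp add: rconst_def nvar_def)
  moreover have "([:2:] * [:0, 1:] - [:c:]) * [:r:] + 1 \<noteq> 0"
    using assms by (simp add: one_pCons)
  ultimately show ?thesis by (metis to_fract_eq_0_iff)
qed

lemma alpha_decomp:
  assumes "r \<noteq> 0"
  shows "pf_decomp r (alpha v r) (d_coeff v r)"
proof -
  note D = affine_nonzero[OF assms, of 1] affine_nonzero[OF assms, of 2]
    affine_nonzero[OF assms, of 3]
  have neg: "rconst (- a) = - rconst a" for a
    using rconst_hom(5)[of 0 a] by (simp add: rconst_hom)
  have two: "(2::ratfun) \<noteq> 0" by (simp add: rconst_def flip: rconst_hom(3))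
  have "rconst (1 / (256 * r^6)) * rconst (256 * r^6) = 1"
    using assms by (simp add: rconst_hom(2) flip: rconst_hom(6))
  hence c: "rconst (1 / (256 * r^6)) * (256 * rconst r^6 * z) = z" for z
    by (simp add: rconst_hom mult.assoc[symmetric])
  have sum: "(\<Sum>k\<in>{0..4}. f k) = f 0 + f 1 + f 2 + f 3 + f 4" for f :: "nat \<Rightarrow> ratfun"
    by (simp add: eval_nat_numeral)
  have "256 * rconst r^6 * alpha v r = (\<Sum>k\<in>{0..4}. rconst (d_coeff v r k) * y_fun r k)"
    using decomp_identity[OF two, of nvar "rconst r" "rconst (b0 v)" "rconst (b1 v)" "rconst (b2 v)"
        "rconst (s2 v)" "rconst (s1 v)"] D
    unfolding sum
    by (simp add: alpha_def gam_def xseq_def y_fun_def d_coeff_def p1_def p2_def p3_def p4_def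
        rconst_hom neg Let_def del: add_uminus_conv_diff)
  thus ?thesis unfolding pf_decomp_def using c by metis
qed

(* For r not in {0, 1, 1/2, 1/3} the functions y_fun r 0, ..., y_fun r 4 are linearly
   independent, so d 0, ..., d 4 are uniquely determined by pf_decomp r f d, and
   for f = alpha v r they are given by d_coeff v r. *)

definition C_sub :: "complex \<Rightarrow> nat set \<Rightarrow> ratfun set" where
  "C_sub r A = {f \<in> C_fam r. \<exists>d. pf_decomp r f d \<and> (\<forall>k\<in>{0..4}. d k \<noteq> 0 \<longleftrightarrow> k \<in> A)}"

end

theory Submission
  imports Defs
begin

text \<open>
  Since \<open>4 r n (n r - 2 r + 1) = u\<^sup>2 - (2 r - 1)\<^sup>2\<close> for \<open>u = 2 n r - 2 r + 1\<close>, all the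
  \<open>y\<^sub>k\<close> are rational functions of \<open>z = u\<^sup>2\<close>; their poles at \<open>z = 0\<close> and \<open>z = r\<^sup>2\<close> separate
  \<open>y\<^sub>4\<close> and \<open>y\<^sub>3\<close> from the polynomial part, which gives linear independence. Hence the \<open>d\<^sub>k\<close> are
  determined by the function, and \<open>d\<^sub>2 = d\<^sub>4 - d\<^sub>3\<close> excludes every \<open>A\<close> that meets \<open>{2,3,4}\<close> in exactly
  one element.

  Conversely, the \<open>d\<^sub>k\<close> depend on the parameters only through \<open>b = b\<^sub>2\<close> and
  \<open>(P, Q, W) = (p\<^sub>2, p\<^sub>3, p\<^sub>4) / (2 r\<^sup>2)\<close>, which can be prescribed freely, and
  \<open>p\<^sub>1 = 2 r b (P - Q) - (P + Q - 2 W)\<^sup>2 + b\<^sup>2 (r - 1) (3 r - 1)\<close>. With \<open>\<sigma> = P + Q - 2 W\<close> and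
  \<open>b = 1\<close>, the equation \<open>p\<^sub>1 = 0\<close> is linear in \<open>P - Q\<close>, so \<open>\<sigma>\<close> and \<open>W\<close> parametrise its solutions.
  Each admissible pattern is then realised by generic values, as the excluded ones are
  zeros of finitely many nonzero polynomials.
\<close>

section \<open>Linear independence of the \<open>y_fun r k\<close> and uniqueness of the
  decomposition\<close>

text \<open>The conclusion is free of division, so for \<open>n = nvar\<close> it can be read as an
  identity of polynomials and evaluated at every complex point, the poles of
  \<open>y_fun r 3\<close> and \<open>y_fun r 4\<close> included.\<close>

lemma pf_decomp_clear_denominators:
  fixes n q :: "'a::field"
  assumes "2*n*q-q+1 \<noteq> 0" "2*n*q-2*q+1 \<noteq> 0" "2*n*q-3*q+1 \<noteq> 0"
    and "D0*((4*q^2*n)^2*(n*q-2*q+1)^2) + D1*(4*q^3*n*(n*q-2*q+1)) + D2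
      + D3*((q-1)*(3*q-1)/((2*n*q-q+1)*(2*n*q-3*q+1)))
      + D4*(-((2*q-1)^2)/(2*n*q-2*q+1)^2) = 0"
  shows "(D0*((4*q^2*n)^2*(n*q-2*q+1)^2) + D1*(4*q^3*n*(n*q-2*q+1)) + D2)
        * (2*n*q-2*q+1)^2 * ((2*n*q-q+1)*(2*n*q-3*q+1))
      + D3*((q-1)*(3*q-1)) * (2*n*q-2*q+1)^2
      - D4*(2*q-1)^2 * ((2*n*q-q+1)*(2*n*q-3*q+1)) = 0"
proof -
  \<comment> \<open>Opaque names for the denominators and coefficients keep
    \<open>field_simps\<close> from multiplying them out.\<close>
  define u where "u = (2*n*q-2*q+1)^2"
  define w where "w = (2*n*q-q+1)*(2*n*q-3*q+1)"
  define Y where "Y = D0*((4*q^2*n)^2*(n*q-2*q+1)^2) + D1*(4*q^3*n*(n*q-2*q+1)) + D2"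
  define c where "c = D3*((q-1)*(3*q-1))"
  define e where "e = D4*(2*q-1)^2"
  have "u \<noteq> 0" "w \<noteq> 0" using assms by (simp_all add: u_def w_def)
  moreover have "Y + c / w - e / u = 0"
    using assms(4) unfolding u_def w_def Y_def c_def e_def by simp
  ultimately have "Y * u * w + c * u - e * w = 0"
    by (simp add: field_simps)
  thus ?thesis unfolding u_def w_def Y_def c_def e_def .
qed

lemma y_fun_simps:
  "y_fun r 0 = (4 * rconst r^2 * nvar)^2 * (nvar * rconst r - 2 * rconst r + 1)^2"
  "y_fun r (Suc 0) = 4 * rconst r^3 * nvar * (nvar * rconst r - 2 * rconst r + 1)"
  "y_fun r 2 = 1"
  "y_fun r 3 = (rconst r - 1) * (3 * rconst r - 1)
    / ((2 * nvar * rconst r - rconst r + 1) * (2 * nvar * rconst r - 3 * rconst r + 1))"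
  "y_fun r 4 = - ((2 * rconst r - 1)^2) / (2 * nvar * rconst r - 2 * rconst r + 1)^2"
  by (simp_all add: y_fun_def Let_def)

lemma sum_0_to_4: "(\<Sum>k\<in>{0..4::nat}. f k) = f 0 + f 1 + f 2 + f 3 + f 4"
  for f :: "nat \<Rightarrow> 'a::comm_monoid_add"
  by (simp add: eval_nat_numeral)

lemma to_fract_numeral: "to_fract (numeral k) = (numeral k :: ratfun)"
  by (simp add: rconst_def numeral_poly flip: rconst_hom(3))

lemma to_fract_power: "to_fract (p ^ k) = to_fract p ^ k" for p :: "complex poly"
  by (induction k) simp_all

lemma y_fun_independent:
  assumes r: "r \<notin> {0, 1, 1/2, 1/3}"
    and sum: "(\<Sum>k\<in>{0..4}. rconst (d k) * y_fun r k) = 0"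
    and k: "k \<in> {0..4}"
  shows "d k = 0"
proof -
  have r': "r \<noteq> 0" "r \<noteq> 1" "2*r \<noteq> 1" "3*r \<noteq> 1"
    using r by (auto simp: field_simps)
  define P where "P = (let n = [:0,1:]; q = [:r:] in
        ([:d 0:]*((4*q^2*n)^2*(n*q-2*q+1)^2) + [:d 1:]*(4*q^3*n*(n*q-2*q+1)) + [:d 2:])
        * (2*n*q-2*q+1)^2 * ((2*n*q-q+1)*(2*n*q-3*q+1))
      + [:d 3:]*((q-1)*(3*q-1)) * (2*n*q-2*q+1)^2
      - [:d 4:]*(2*q-1)^2 * ((2*n*q-q+1)*(2*n*q-3*q+1)))"
  have "to_fract P = 0"
    unfolding P_def Let_def to_fract_add to_fract_diff to_fract_mult to_fract_power
      to_fract_numeral to_fract_1 rconst_def[symmetric] nvar_def[symmetric]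
  proof (rule pf_decomp_clear_denominators)
    show "2 * nvar * rconst r - rconst r + 1 \<noteq> 0"
      using affine_nonzero[OF r'(1), of 1] by (simp add: rconst_hom algebra_simps)
    show "2 * nvar * rconst r - 2 * rconst r + 1 \<noteq> 0"
      using affine_nonzero[OF r'(1), of 2] by (simp add: rconst_hom algebra_simps)
    show "2 * nvar * rconst r - 3 * rconst r + 1 \<noteq> 0"
      using affine_nonzero[OF r'(1), of 3] by (simp add: rconst_hom algebra_simps)
  qed (use sum in \<open>simp add: sum_0_to_4 y_fun_simps\<close>)
  hence P0: "poly P x = 0" for x by simp
  let ?e = "(2*r-1)^2"
  have key: "(d 0 * r^2*(z - ?e)^2 + d 1 * r^2*(z - ?e) + d 2) * z * (z - r^2)
      + d 3 * ((r-1)*(3*r-1)) * z - d 4 * ?e * (z - r^2) = 0" for z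
  proof -
    \<comment> \<open>This \<open>x\<close> solves \<open>2*x*r - 2*r + 1 = csqrt z\<close>, so
      every complex \<open>z\<close> occurs as the square of that expression and the identity in
      \<open>x\<close> becomes one in \<open>z\<close>.\<close>
    define x where "x = (csqrt z + 2*r - 1) / (2*r)"
    have x: "2*x*r-2*r+1 = csqrt z" using r' by (simp add: x_def field_simps)
    have m: "4*r*(x*(x*r-2*r+1)) = z - ?e"
    proof -
      have "4*r*(x*(x*r-2*r+1)) = (2*x*r-2*r+1)^2 - ?e" by algebra
      thus ?thesis by (simp add: x)
    qed
    have w: "(2*x*r-r+1)*(2*x*r-3*r+1) = z - r^2"
    proof -
      have "(2*x*r-r+1)*(2*x*r-3*r+1) = (2*x*r-2*r+1)^2 - r^2" by algebra
      thus ?thesis by (simp add: x)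
    qed
    have y: "(4*r^2*x)^2*(x*r-2*r+1)^2 = r^2*(z - ?e)^2"
      "4*r^3*x*(x*r-2*r+1) = r^2*(z - ?e)"
      unfolding m[symmetric] by algebra+
    have "poly P x = (d 0*((4*r^2*x)^2*(x*r-2*r+1)^2) + d 1*(4*r^3*x*(x*r-2*r+1)) + d 2)
        * (2*x*r-2*r+1)^2 * ((2*x*r-r+1)*(2*x*r-3*r+1))
      + d 3*((r-1)*(3*r-1)) * (2*x*r-2*r+1)^2
      - d 4*(2*r-1)^2 * ((2*x*r-r+1)*(2*x*r-3*r+1))"
      by (simp add: P_def Let_def mult_ac)
    thus ?thesis unfolding y w x P0 by (simp add: mult.assoc)
  qed
  \<comment> \<open>Evaluation at \<open>0\<close>, \<open>r^2\<close> and \<open>?e\<close>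
    isolates \<open>d 4\<close>, \<open>d 3\<close> and \<open>d 2\<close> in turn; the accompanying
    factors are built from \<open>r\<close>, \<open>r-1\<close>, \<open>2*r-1\<close> and
    \<open>3*r-1\<close>, all nonzero.\<close>
  have d4: "d 4 = 0" using key[of 0] r' by simp
  have d3: "d 3 = 0" using key[of "r^2"] r' d4 by simp
  have "?e - r^2 = (r-1)*(3*r-1)" by algebra
  hence d2: "d 2 = 0" using key[of ?e] r' d4 d3 by simp
  \<comment> \<open>With \<open>d 2\<close>, \<open>d 3\<close>, \<open>d 4\<close> gone,
    \<open>key\<close> states that \<open>r^2\<close> times this product vanishes everywhere, hence
    its last factor is the zero polynomial.\<close>
  define L where "L = [:0,1:] * [:- (r^2),1:] * [:- ?e, 1:] * [:d 1 - d 0 * ?e, d 0:]"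
  have L: "r^2 * poly L z = 0" for z
    using key[of z] unfolding d4 d3 d2 by (simp add: L_def) algebra
  have "\<forall>z. poly L z = 0" using L r' by simp
  hence "L = 0" by (simp only: poly_all_0_iff_0)
  hence "d 0 = 0 \<and> d 1 = 0" by (auto simp: L_def)
  moreover from k have "k \<in> {0,1,2,3,4}" by auto
  ultimately show ?thesis using d2 d3 d4 by auto
qed

lemma pf_decomp_unique:
  assumes "r \<notin> {0, 1, 1/2, 1/3}" "pf_decomp r f d" "pf_decomp r f d'" "k \<in> {0..4}"
  shows "d k = d' k"
proof -
  have "rconst (1 / (256 * r^6)) \<noteq> 0"
    using assms(1) by (simp add: rconst_def)
  moreover have "rconst (1 / (256 * r^6)) * (\<Sum>k\<in>{0..4}. rconst (d k) * y_fun r k)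
      = rconst (1 / (256 * r^6)) * (\<Sum>k\<in>{0..4}. rconst (d' k) * y_fun r k)"
    using assms(2,3) unfolding pf_decomp_def by (rule trans[OF sym])
  ultimately have "(\<Sum>k\<in>{0..4}. rconst (d k) * y_fun r k) = (\<Sum>k\<in>{0..4}. rconst (d' k) * y_fun r k)"
    by (simp only: mult_cancel_left) simp
  hence "(\<Sum>k\<in>{0..4}. rconst (d k - d' k) * y_fun r k) = 0"
    by (simp add: rconst_hom left_diff_distrib sum_subtractf)
  from y_fun_independent[OF assms(1) this assms(4)] show ?thesis by simp
qed

section \<open>Free coordinates on the parameter space\<close>

text \<open>The direction \<open>(b\<^sub>0, s\<^sub>1, s\<^sub>2) = (1, -1, -r)\<close> changes none of the quantities below, so \<open>b\<^sub>0 = 0\<close> is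
  no loss.\<close>

lemma obtain_params:
  fixes r b P Q W :: complex
  assumes r: "r \<noteq> 0"
  obtains v where "b2 v = b" "p2 v r = 2*r^2*P" "p3 v r = 2*r^2*Q" "p4 v r = 2*r^2*W"
    "p1 v r = 2*r*b*(P-Q) - (P+Q-2*W)^2 + b^2*((r-1)*(3*r-1))"
    "8*r^2*(s1 v + b0 v) = (1+r)*P + (1-r)*Q + (1-r^2)*(b-2*W)"
    "8*r*(s2 v - r * s1 v) = (1-r^2)*(b+2*W) - (1-r)*P - (1+r)*Q"
proof -
  \<comment> \<open>For \<open>b0 = 0\<close> the system is triangular:
    \<open>p2 + p3 - 2 * p4\<close> involves \<open>b1\<close> and \<open>b2\<close> alone,
    \<open>p2 - p3\<close> involves \<open>s2\<close> and \<open>b2\<close> alone, and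
    \<open>p4\<close> then yields \<open>s1\<close>.\<close>
  define B1 where "B1 = b + (P+Q-2*W+b)/(2*r)"
  define S2 where "S2 = (r*(P-Q) + b*(1-r^2))/(4*r)"
  define S1 where "S1 = (2*r^2*W + (P+Q-2*W) + r*(P-Q) + b*(1-r^2))/(8*r^2)"
  define v where "v = \<lparr>b0 = 0, b1 = B1, b2 = b, s1 = S1, s2 = S2\<rparr>"
  have v: "b0 v = 0" "b1 v = B1" "b2 v = b" "s1 v = S1" "s2 v = S2" by (simp_all add: v_def)
  have B1: "2*r*B1 = 2*r*b + (P+Q-2*W+b)" using r by (simp add: B1_def field_simps)
  have S2: "4*r*S2 = r*(P-Q) + b*(1-r^2)" using r by (simp add: S2_def)
  have S1: "8*r^2*S1 = 2*r^2*W + (P+Q-2*W) + r*(P-Q) + b*(1-r^2)" using r by (simp add: S1_def)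
  have "p2 v r = 2*r^2*P" using B1 S1 S2 unfolding p2_def v by algebra
  moreover have "p3 v r = 2*r^2*Q" using B1 S1 S2 unfolding p3_def v by algebra
  moreover have "p4 v r = 2*r^2*W" using B1 S1 S2 unfolding p4_def v by algebra
  moreover have "p1 v r = 2*r*b*(P-Q) - (P+Q-2*W)^2 + b^2*((r-1)*(3*r-1))"
    using B1 S2 unfolding p1_def v by algebra
  moreover have "8*r^2*(s1 v + b0 v) = (1+r)*P + (1-r)*Q + (1-r^2)*(b-2*W)"
    using S1 unfolding v by algebra
  moreover have "8*r*(s2 v - r * s1 v) = (1-r^2)*(b+2*W) - (1-r)*P - (1+r)*Q"
  proof -
    have "r * (8*r*(s2 v - r * s1 v)) = r * ((1-r^2)*(b+2*W) - (1-r)*P - (1+r)*Q)"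
      using S1 S2 unfolding v by algebra
    thus ?thesis using r by simp
  qed
  ultimately show thesis using that v by blast
qed

text \<open>The expressions in \<open>F\<close> and \<open>G\<close> are \<open>s1 + b0\<close> and
  \<open>s2 - r * s1\<close> up to the nonzero factors \<open>8*r^2\<close> and \<open>8*r\<close>;
  the conditions on \<open>A\<close> say which \<open>d_coeff v r k\<close> are nonzero.\<close>

lemma C_sub_nonemptyI:
  assumes r: "r \<noteq> 0"
    and F: "(1+r)*P + (1-r)*Q + (1-r^2)*(b-2*W) \<noteq> 0"
    and G: "(1-r^2)*(b+2*W) - (1-r)*P - (1+r)*Q \<noteq> 0"
    and A: "0 \<in> A \<longleftrightarrow> b \<noteq> 0"
      "1 \<in> A \<longleftrightarrow> 2*r*b*(P-Q) - (P+Q-2*W)^2 + b^2*((r-1)*(3*r-1)) \<noteq> 0"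
      "2 \<in> A \<longleftrightarrow> P * Q \<noteq> W^2" "3 \<in> A \<longleftrightarrow> P * Q \<noteq> 0" "4 \<in> A \<longleftrightarrow> W \<noteq> 0"
  shows "C_sub r A \<noteq> {}"
proof -
  obtain v where v: "b2 v = b" "p2 v r = 2*r^2*P" "p3 v r = 2*r^2*Q" "p4 v r = 2*r^2*W"
    "p1 v r = 2*r*b*(P-Q) - (P+Q-2*W)^2 + b^2*((r-1)*(3*r-1))"
    "8*r^2*(s1 v + b0 v) = (1+r)*P + (1-r)*Q + (1-r^2)*(b-2*W)"
    "8*r*(s2 v - r * s1 v) = (1-r^2)*(b+2*W) - (1-r)*P - (1+r)*Q"
    using obtain_params[OF r] by blast
  have "s1 v + b0 v \<noteq> 0" "s2 v - r * s1 v \<noteq> 0" using F G v(6,7) by auto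
  hence "alpha v r \<in> C_fam r" using r unfolding C_fam_def by auto
  moreover have "d_coeff v r k \<noteq> 0 \<longleftrightarrow> k \<in> A" if "k \<in> {0..4}" for k
  proof -
    have "(2*r^2*W)^2 - 2*r^2*P * (2*r^2*Q) = 4*r^4*(W^2 - P*Q)" by algebra
    hence d2: "d_coeff v r 2 = 4*r^4*(W^2 - P*Q)" unfolding d_coeff_def v by simp
    have d: "d_coeff v r 0 = b^2"
      "d_coeff v r 1 = 2*r*b*(P-Q) - (P+Q-2*W)^2 + b^2*((r-1)*(3*r-1))"
      "d_coeff v r 3 = 4*r^4*(P*Q)" "d_coeff v r 4 = 4*r^4*W^2"
      unfolding d_coeff_def v by (simp_all add: power_mult_distrib)
    from that consider "k = 0" | "k = 1" | "k = 2" | "k = 3" | "k = 4" by fastforce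
    thus ?thesis by cases (use r in \<open>simp_all only: d d2 A, auto\<close>)
  qed
  ultimately have "alpha v r \<in> C_sub r A"
    using alpha_decomp[OF r] unfolding C_sub_def by blast
  thus ?thesis by blast
qed

section \<open>Realisation of the 19 patterns\<close>

text \<open>The product of the list is a nonzero polynomial over an infinite field, so it has a
  non-root.\<close>

lemma generic_point:
  assumes "\<forall>p\<in>set ps. p \<noteq> 0"
  obtains x :: complex where "\<forall>p\<in>set ps. poly p x \<noteq> 0"
proof -
  have "prod_list ps \<noteq> 0" using assms by (simp add: prod_list_zero_iff) blast
  then obtain x where "poly (prod_list ps) x \<noteq> 0"
    using poly_all_0_iff_0 by blast
  moreover have "poly (prod_list qs) x = 0" if "p \<in> set qs" "poly p x = 0" for p qs
    using that by (induction qs) auto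
  ultimately show thesis using that by blast
qed

text \<open>These are the patterns without \<open>0\<close>. For \<open>b = 0\<close> the
  coefficient \<open>d 1\<close> is \<open>-(P+Q-2*W)^2\<close>, so each pattern only prescribes
  which of \<open>P+Q-2*W\<close>, \<open>P*Q-W^2\<close>, \<open>P*Q\<close> and \<open>W\<close>
  vanish.\<close>

lemma C_sub_nonempty_b2_zero:
  assumes r: "r \<noteq> 0" "r \<noteq> 1" "r \<noteq> -1"
    and A: "A \<in> {{1,2,3,4}, {2,3,4}, {1,3,4}, {1,2,4}, {1,2,3}, {3,4}, {2,4}, {2,3}, {1}}"
  shows "C_sub r A \<noteq> {}"
proof -
  have r1: "1 + r \<noteq> 0" "1 - r \<noteq> 0" "1 - r^2 \<noteq> 0"
    using r by (auto simp: add_eq_0_iff power2_eq_1_iff)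
  have I: "C_sub r A \<noteq> {}"
    if "(1+r)*P + (1-r)*Q - 2*(1-r^2)*W \<noteq> 0" "2*(1-r^2)*W - (1-r)*P - (1+r)*Q \<noteq> 0"
      "0 \<notin> A" "1 \<in> A \<longleftrightarrow> P + Q \<noteq> 2*W"
      "2 \<in> A \<longleftrightarrow> P * Q \<noteq> W^2" "3 \<in> A \<longleftrightarrow> P * Q \<noteq> 0" "4 \<in> A \<longleftrightarrow> W \<noteq> 0" for A P Q W
  proof (rule C_sub_nonemptyI[OF r(1), where b=0 and P=P and Q=Q and W=W])
    have e: "(1+r)*P + (1-r)*Q + (1-r^2)*(0-2*W) = (1+r)*P + (1-r)*Q - 2*(1-r^2)*W"
      "(1-r^2)*(0+2*W) - (1-r)*P - (1+r)*Q = 2*(1-r^2)*W - (1-r)*P - (1+r)*Q" by algebra+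
    show "(1+r)*P + (1-r)*Q + (1-r^2)*(0-2*W) \<noteq> 0"
      "(1-r^2)*(0+2*W) - (1-r)*P - (1+r)*Q \<noteq> 0" unfolding e by (fact that)+
  qed (use that in simp_all)
  have "C_sub r {1} \<noteq> {}"
    by (rule I[of 0 1 0]) (use r1 in auto)
  moreover have "C_sub r {2,3} \<noteq> {}"
    by (rule I[of 1 "-1" 0]) (use r in auto)
  moreover have "C_sub r {2,4} \<noteq> {}"
  proof (rule I[of 2 0 1])
    have "(1+r)*2 + (1-r)*0 - 2*(1-r^2)*1 = 2*r*(1+r)"
      "2*(1-r^2)*1 - (1-r)*2 - (1+r)*0 = 2*r*(1-r)" by algebra+
    thus "(1+r)*2 + (1-r)*0 - 2*(1-r^2)*1 \<noteq> 0" "2*(1-r^2)*1 - (1-r)*2 - (1+r)*0 \<noteq> 0"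
      using r r1 by simp_all
  qed auto
  moreover have "C_sub r {3,4} \<noteq> {}"
    by (rule I[of 1 1 1]) (use r in auto)
  moreover have "C_sub r {1,2,3} \<noteq> {}"
    by (rule I[of 1 1 0]) auto
  moreover have "C_sub r {1,2,4} \<noteq> {}"
    by (rule I[of 0 0 1]) (use r1 in auto)
  moreover have "C_sub r {2,3,4} \<noteq> {}"
  proof -
    \<comment> \<open>The choice \<open>P = 1+t\<close>, \<open>Q = 1-t\<close>,
      \<open>W = 1\<close> satisfies \<open>P+Q = 2*W\<close> identically, and
      \<open>P*Q - W^2 = -t^2\<close>.\<close>
    obtain t where t: "\<forall>p\<in>set [[:0,1:], [:1,1:], [:-1,1:], [:r,1:], [:-r,1:]]. poly p t \<noteq> 0"
      by (rule generic_point[of "[[:0,1:], [:1,1:], [:-1,1:], [:r,1:], [:-r,1:]]"]) auto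
    have "(1+r)*(1+t) + (1-r)*(1-t) - 2*(1-r^2)*1 = 2*r*(t+r)"
      "2*(1-r^2)*1 - (1-r)*(1+t) - (1+r)*(1-t) = 2*r*(t-r)" by algebra+
    moreover have "(1+t)*(1-t) = 1 - t^2" by algebra
    hence "(1+t)*(1-t) \<noteq> 1^2" using t by simp
    moreover have "(1+t)*(1-t) \<noteq> 0" using t by (auto simp: add.commute)
    ultimately show ?thesis
      using t r by (intro I[of "1+t" "1-t" 1]) (auto simp: add.commute)
  qed
  moreover have "C_sub r {1,3,4} \<noteq> {}"
  proof -
    \<comment> \<open>The choice \<open>P = t^2\<close>, \<open>Q = 1\<close>, \<open>W = t\<close>
      satisfies \<open>P*Q = W^2\<close> identically, and \<open>P+Q-2*W = (t-1)^2\<close>. The two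
      quadratics are the nondegeneracy factors up to sign.\<close>
    obtain t where t: "\<forall>p\<in>set [[:0,1:], [:-1,1:], [:1-r, -2*(1-r^2), 1+r:],
        [:1+r, -2*(1-r^2), 1-r:]]. poly p t \<noteq> 0"
      by (rule generic_point[of "[[:0,1:], [:-1,1:], [:1-r, -2*(1-r^2), 1+r:],
        [:1+r, -2*(1-r^2), 1-r:]]"]) (use r1 in auto)
    have F: "(1+r)*t^2 + (1-r)*1 - 2*(1-r^2)*t = poly [:1-r, -2*(1-r^2), 1+r:] t"
      and G: "2*(1-r^2)*t - (1-r)*t^2 - (1+r)*1 = - poly [:1+r, -2*(1-r^2), 1-r:] t"
      by (simp_all, algebra+)
    have F': "(1+r)*t^2 + (1-r)*1 - 2*(1-r^2)*t \<noteq> 0"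
      unfolding F using t by simp
    have G': "2*(1-r^2)*t - (1-r)*t^2 - (1+r)*1 \<noteq> 0"
      unfolding G neg_equal_0_iff_equal using t by simp
    have "t^2 + 1 \<noteq> 2*t"
    proof
      assume "t^2 + 1 = 2*t"
      hence "(t-1)^2 = 0" by algebra
      thus False using t by simp
    qed
    thus ?thesis
      using t by (intro I[OF F' G']) auto
  qed
  moreover have "C_sub r {1,2,3,4} \<noteq> {}"
  proof -
    \<comment> \<open>For \<open>P = Q = t\<close>, \<open>W = 1\<close> both nondegeneracy factors
      are multiples of \<open>t-(1-r^2)\<close>.\<close>
    obtain t where t: "\<forall>p\<in>set [[:0,1:], [:1,1:], [:-1,1:], [:-(1-r^2),1:]]. poly p t \<noteq> 0"
      by (rule generic_point[of "[[:0,1:], [:1,1:], [:-1,1:], [:-(1-r^2),1:]]"]) auto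
    have nz: "t-(1-r^2) \<noteq> 0" using t by (simp add: algebra_simps)
    have "(1+r)*t + (1-r)*t - 2*(1-r^2)*1 = 2 * (t-(1-r^2))" by algebra
    with nz have F: "(1+r)*t + (1-r)*t - 2*(1-r^2)*1 \<noteq> 0"
      by (metis mult_eq_0_iff zero_neq_numeral)
    have "2*(1-r^2)*1 - (1-r)*t - (1+r)*t = -2 * (t-(1-r^2))" by algebra
    with nz have G: "2*(1-r^2)*1 - (1-r)*t - (1+r)*t \<noteq> 0"
      by (metis mult_eq_0_iff neg_equal_0_iff_equal zero_neq_numeral)
    have "t * t \<noteq> 1^2"
      using t square_eq_1_iff[of t] by (auto simp: add_eq_0_iff)
    thus ?thesis
      using t by (intro I[OF F G]) auto
  qed
  ultimately show ?thesis using A by auto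
qed

text \<open>These are the patterns containing \<open>0\<close> and \<open>1\<close>. For
  \<open>b = 1\<close> and \<open>P = Q\<close> the coefficient \<open>d 1\<close> is
  \<open>(r-1)*(3*r-1) - (2*P-2*W)^2\<close>, which is nonzero at \<open>P = W\<close> and at
  generic points.\<close>

lemma C_sub_nonempty_b2_one_generic:
  assumes r: "r \<notin> {0, 1, 1/3}" "r \<noteq> -1"
    and A: "A \<in> {{0,1,2,3,4}, {0,1,3,4}, {0,1,2,4}, {0,1,2,3}, {0,1}}"
  shows "C_sub r A \<noteq> {}"
proof -
  have r1: "r \<noteq> 0" "1 + r \<noteq> 0" "1 - r \<noteq> 0" "1 - r^2 \<noteq> 0"
    using r by (auto simp: add_eq_0_iff power2_eq_1_iff)
  have "r - 1 \<noteq> 0" "3*r - 1 \<noteq> 0" using r by (auto simp: field_simps)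
  hence e: "(r-1)*(3*r-1) \<noteq> 0" by simp
  have I: "C_sub r A \<noteq> {}"
    if "2*P - 2*(1-r^2)*W + (1-r^2) \<noteq> 0" "-2*P + 2*(1-r^2)*W + (1-r^2) \<noteq> 0"
      "0 \<in> A" "1 \<in> A" "(r-1)*(3*r-1) - (2*P-2*W)^2 \<noteq> 0"
      "2 \<in> A \<longleftrightarrow> P * P \<noteq> W^2" "3 \<in> A \<longleftrightarrow> P \<noteq> 0" "4 \<in> A \<longleftrightarrow> W \<noteq> 0" for A P W
  proof (rule C_sub_nonemptyI[OF r1(1), where b=1 and P=P and Q=P and W=W])
    have e: "(1+r)*P + (1-r)*P + (1-r^2)*(1-2*W) = 2*P - 2*(1-r^2)*W + (1-r^2)"
      "(1-r^2)*(1+2*W) - (1-r)*P - (1+r)*P = -2*P + 2*(1-r^2)*W + (1-r^2)" by algebra+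
    show "(1+r)*P + (1-r)*P + (1-r^2)*(1-2*W) \<noteq> 0"
      "(1-r^2)*(1+2*W) - (1-r)*P - (1+r)*P \<noteq> 0" unfolding e by (fact that)+
    show "(1 \<in> A) = (2*r*1*(P-P) - (P+P-2*W)^2 + 1^2*((r-1)*(3*r-1)) \<noteq> 0)"
      using that(4,5) by (simp add: mult_2[symmetric])
  qed (use that in simp_all)
  let ?e = "(r-1)*(3*r-1)" and ?c = "1-r^2"
  \<comment> \<open>One \<open>t\<close> serves the four pairs \<open>(P, W)\<close> equal to
    \<open>(t, 0)\<close>, \<open>(0, t)\<close>, \<open>(t, t)\<close> and \<open>(t, 2*t)\<close>.
    The linear polynomials after the first are the nondegeneracy factors there, nonzero because of
    their constant term \<open>?c\<close>; the quadratic is \<open>d 1\<close> whenever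
    \<open>P - W\<close> is \<open>t\<close> or \<open>-t\<close>.\<close>
  obtain t where t: "\<forall>p\<in>set [[:0,1:], [:?e,0,-4:], [:?c,2:], [:?c,-2:], [:?c,-2*?c:], [:?c,2*?c:],
      [:?c, 2-2*?c:], [:?c, -2+2*?c:], [:?c, 2-4*?c:], [:?c, -2+4*?c:]]. poly p t \<noteq> 0"
    by (rule generic_point[of "[[:0,1:], [:?e,0,-4:], [:?c,2:], [:?c,-2:], [:?c,-2*?c:], [:?c,2*?c:],
      [:?c, 2-2*?c:], [:?c, -2+2*?c:], [:?c, 2-4*?c:], [:?c, -2+4*?c:]]"]) (use r1 in auto)
  have t0: "t \<noteq> 0" using t by simp
  have te: "?e - 4*t^2 \<noteq> 0" using t by (simp add: power2_eq_square algebra_simps)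
  have "C_sub r {0,1} \<noteq> {}"
    by (rule I[of 0 0]) (use r1 e in auto)
  moreover have "C_sub r {0,1,2,3} \<noteq> {}"
    by (rule I[of t 0]) (use t te in \<open>auto simp: algebra_simps power_mult_distrib\<close>)
  moreover have "C_sub r {0,1,2,4} \<noteq> {}"
    by (rule I[of 0 t]) (use t te in \<open>auto simp: algebra_simps power_mult_distrib\<close>)
  moreover have "C_sub r {0,1,3,4} \<noteq> {}"
    by (rule I[of t t]) (use t e in \<open>auto simp: algebra_simps power2_eq_square\<close>)
  moreover have "C_sub r {0,1,2,3,4} \<noteq> {}"
    by (rule I[of t "2*t"]) (use t te in \<open>auto simp: algebra_simps power2_eq_square\<close>)
  ultimately show ?thesis using A by auto
qed

text \<open>These are the patterns containing \<open>0\<close> but not \<open>1\<close>. For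
  \<open>b = 1\<close> the condition \<open>d 1 = 0\<close> reads
  \<open>2*r*(P-Q) = s^2 - (r-1)*(3*r-1)\<close> with \<open>s = P+Q-2*W\<close>, so
  \<open>s\<close> and \<open>W\<close> determine \<open>P\<close> and \<open>Q\<close>.\<close>

lemma C_sub_nonempty_b2_one_p1_zero:
  assumes r: "r \<notin> {0, 1, 1/3}" "r \<noteq> -1"
    and A: "A \<in> {{0,2,3,4}, {0,3,4}, {0,2,4}, {0,2,3}, {0}}"
  shows "C_sub r A \<noteq> {}"
proof -
  have r1: "r \<noteq> 0" "1 + r \<noteq> 0" "1 - r \<noteq> 0" "3*r - 1 \<noteq> 0" "r - 1 \<noteq> 0"
    using r by (auto simp: add_eq_0_iff field_simps)
  \<comment> \<open>Solving for \<open>P\<close> and \<open>Q\<close> gives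
    \<open>4*r*P = 4*r*W + poly P0 s\<close> and \<open>4*r*Q = 4*r*W - poly Q0 s\<close>. Twice the
    nondegeneracy factors are \<open>poly F0 s + 4*r^2*W\<close> and
    \<open>poly G0 s - 4*r^2*W\<close>.\<close>
  define P0 where "P0 = [:-(3*r-1)*(r-1), 2*r, 1:]"
  define Q0 where "Q0 = [:-(3*r-1)*(r-1), -2*r, 1:]"
  define F0 where "F0 = [:1+4*r-5*r^2, 2, 1:]"
  define G0 where "G0 = [:1+4*r-5*r^2, -2, 1:]"
  note defs = P0_def Q0_def F0_def G0_def
  have I: "C_sub r A \<noteq> {}"
    if "poly F0 s + 4*r^2*W \<noteq> 0" "poly G0 s - 4*r^2*W \<noteq> 0"
      "0 \<in> A" "1 \<notin> A"
      "2 \<in> A \<longleftrightarrow> 16*r^2*s*W \<noteq> poly P0 s * poly Q0 s"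
      "3 \<in> A \<longleftrightarrow> 4*r*W + poly P0 s \<noteq> 0 \<and> 4*r*W - poly Q0 s \<noteq> 0" "4 \<in> A \<longleftrightarrow> W \<noteq> 0" for A s W
  proof -
    define P where "P = W + poly P0 s / (4*r)"
    define Q where "Q = W - poly Q0 s / (4*r)"
    have P: "4*r*P = 4*r*W + poly P0 s" and Q: "4*r*Q = 4*r*W - poly Q0 s"
      using r1 by (simp_all add: P_def Q_def field_simps)
    have "4*r*(P+Q-2*W) = 4*r*s" using P Q unfolding defs by simp algebra
    hence s: "P+Q-2*W = s" using r1 by simp
    have "2*(2*r*(P-Q)) = 2*(s^2 - (r-1)*(3*r-1))" using P Q unfolding defs by simp algebra
    hence d: "2*r*(P-Q) = s^2 - (r-1)*(3*r-1)" by (metis mult_left_cancel zero_neq_numeral)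
    have "2*((1+r)*P + (1-r)*Q + (1-r^2)*(1-2*W)) = 2*(P+Q-2*W) + 2*r*(P-Q) + 2*(1-r^2) + 4*r^2*W"
      by algebra
    also have "\<dots> = poly F0 s + 4*r^2*W"
      unfolding s d defs by simp algebra
    finally have F: "(1+r)*P + (1-r)*Q + (1-r^2)*(1-2*W) \<noteq> 0"
      using that(1) by (metis mult_zero_right)
    have "2*((1-r^2)*(1+2*W) - (1-r)*P - (1+r)*Q) = 2*r*(P-Q) - 2*(P+Q-2*W) + 2*(1-r^2) - 4*r^2*W"
      by algebra
    also have "\<dots> = poly G0 s - 4*r^2*W"
      unfolding s d defs by simp algebra
    finally have G: "(1-r^2)*(1+2*W) - (1-r)*P - (1+r)*Q \<noteq> 0"
      using that(2) by (metis mult_zero_right)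
    have D: "poly P0 s - poly Q0 s = 4*r*s" by (simp add: defs algebra_simps)
    have "16*r^2*(P*Q - W^2) = (4*r*P)*(4*r*Q) - (4*r*W)^2" by algebra
    also have "\<dots> = 16*r^2*s*W - poly P0 s * poly Q0 s"
      unfolding P Q using D by algebra
    finally have "P*Q \<noteq> W^2 \<longleftrightarrow> 16*r^2*s*W \<noteq> poly P0 s * poly Q0 s"
      using r1 by (metis eq_iff_diff_eq_0 mult_eq_0_iff power_not_zero zero_neq_numeral)
    moreover have "P*Q \<noteq> 0 \<longleftrightarrow> 4*r*W + poly P0 s \<noteq> 0 \<and> 4*r*W - poly Q0 s \<noteq> 0"
      unfolding P[symmetric] Q[symmetric] using r1 by simp
    ultimately show ?thesis
      using that d s
      by (intro C_sub_nonemptyI[OF r1(1) F G]) auto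
  qed
  have [simp]: "P0 \<noteq> 0" "Q0 \<noteq> 0" "F0 \<noteq> 0" "G0 \<noteq> 0" by (simp_all add: defs)
  have "C_sub r {0} \<noteq> {}"
  \<comment> \<open>The value \<open>3*r-1\<close> is a root of \<open>Q0\<close>, so together with
    \<open>W = 0\<close> it gives \<open>Q = 0\<close> and \<open>d 2\<close>, \<open>d 3\<close>,
    \<open>d 4\<close> all vanish.\<close>
  proof (rule I[of "3*r-1" 0])
    have "poly F0 (3*r-1) = 4*r*(1+r)" "poly G0 (3*r-1) = 4*(1-r)^2" "poly Q0 (3*r-1) = 0"
      by (simp_all add: defs, algebra+)
    thus "poly F0 (3*r-1) + 4*r^2*0 \<noteq> 0" "poly G0 (3*r-1) - 4*r^2*0 \<noteq> 0"
      "((2::nat) \<in> {0}) = (16*r^2*(3*r-1)*0 \<noteq> poly P0 (3*r-1) * poly Q0 (3*r-1))"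
      "((3::nat) \<in> {0}) = (4*r*0 + poly P0 (3*r-1) \<noteq> 0 \<and> 4*r*0 - poly Q0 (3*r-1) \<noteq> 0)"
      using r1 by simp_all
  qed auto
  moreover have "C_sub r {0,2,3} \<noteq> {}"
  proof -
    obtain s where "\<forall>p\<in>set [P0, Q0, F0, G0]. poly p s \<noteq> 0"
      by (rule generic_point[of "[P0, Q0, F0, G0]"]) auto
    thus ?thesis by (intro I[of s 0]) auto
  qed
  moreover have "C_sub r {0,2,4} \<noteq> {}"
  proof -
    \<comment> \<open>Taking \<open>W = poly Q0 s / (4*r)\<close> forces \<open>Q = 0\<close>. The
      two polynomials are the nondegeneracy factors after this substitution.\<close>
    have "coeff (F0 + [:r:]*Q0) 2 = 1+r" "coeff (G0 - [:r:]*Q0) 2 = 1-r"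
      by (simp_all add: defs numeral_2_eq_2)
    hence nz: "F0 + [:r:]*Q0 \<noteq> 0" "G0 - [:r:]*Q0 \<noteq> 0" using r1 by (metis coeff_0)+
    obtain s where s: "\<forall>p\<in>set [Q0, F0 + [:r:]*Q0, G0 - [:r:]*Q0]. poly p s \<noteq> 0"
      by (rule generic_point[of "[Q0, F0 + [:r:]*Q0, G0 - [:r:]*Q0]"]) (use nz in auto)
    have PQ: "poly P0 s = poly Q0 s + 4*r*s" by (simp add: defs algebra_simps)
    have "16*r^2*s*(poly Q0 s / (4*r)) \<noteq> poly P0 s * poly Q0 s"
    proof -
      have "16*r^2*s*(poly Q0 s / (4*r)) = 4*r*s*poly Q0 s"
        using r1 by (simp add: field_simps power2_eq_square)
      thus ?thesis using s by (auto simp: PQ)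
    qed
    thus ?thesis using s r1
      by (intro I[of s "poly Q0 s / (4*r)"]) (auto simp: power2_eq_square)
  qed
  moreover have "C_sub r {0,3,4} \<noteq> {}"
  proof -
    \<comment> \<open>Here \<open>W\<close> is solved from
      \<open>16*r^2*s*W = poly P0 s * poly Q0 s\<close>, which is \<open>P*Q = W^2\<close>.
      Multiplying the nondegeneracy factors by \<open>4*s\<close> turns them into the polynomials
      \<open>?F\<close> and \<open>?G\<close> in \<open>s\<close>.\<close>
    let ?F = "[:0,4:]*F0 + P0*Q0" and ?G = "[:0,4:]*G0 - P0*Q0"
    have "coeff ?F 4 = 1" "coeff ?G 4 = -1"
      by (simp_all add: defs numeral_eq_Suc)
    hence nz: "?F \<noteq> 0" "?G \<noteq> 0" by (metis coeff_0 zero_neq_one zero_neq_neg_one)+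
    obtain s where s: "\<forall>p\<in>set [[:0,1:], P0, Q0, ?F, ?G]. poly p s \<noteq> 0"
      by (rule generic_point[of "[[:0,1:], P0, Q0, ?F, ?G]"]) (use nz in auto)
    have s0: "s \<noteq> 0" "poly P0 s \<noteq> 0" "poly Q0 s \<noteq> 0" using s by auto
    define W where "W = poly P0 s * poly Q0 s / (16*r^2*s)"
    have W: "16*r^2*s*W = poly P0 s * poly Q0 s" using s0 r1 by (simp add: W_def)
    have D: "poly P0 s - poly Q0 s = 4*r*s" by (simp add: defs algebra_simps)
    have "4*s*(poly F0 s + 4*r^2*W) = poly ?F s" using W by simp algebra
    hence F: "poly F0 s + 4*r^2*W \<noteq> 0" using s by force
    have "4*s*(poly G0 s - 4*r^2*W) = poly ?G s" using W by simp algebra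
    hence G: "poly G0 s - 4*r^2*W \<noteq> 0" using s by force
    have "4*s*r*(4*r*W + poly P0 s) = poly P0 s * poly P0 s" using W D by algebra
    hence P: "4*r*W + poly P0 s \<noteq> 0" using s0 by force
    have "4*s*r*(4*r*W - poly Q0 s) = poly Q0 s * poly Q0 s" using W D by algebra
    hence Q: "4*r*W - poly Q0 s \<noteq> 0" using s0 by force
    have "W \<noteq> 0" using s0 r1 by (simp add: W_def)
    thus ?thesis using P Q W by (intro I[OF F G]) auto
  qed
  moreover have "C_sub r {0,2,3,4} \<noteq> {}"
  proof -
    \<comment> \<open>With \<open>s = 1\<close> fixed, each condition excludes the root of one
      linear polynomial in \<open>W\<close> with nonzero slope.\<close>
    let ?ps = "[[:0,1:], [:poly F0 1, 4*r^2:], [:poly G0 1, -4*r^2:], [:poly P0 1, 4*r:],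
      [:-poly Q0 1, 4*r:], [:-(poly P0 1*poly Q0 1), 16*r^2:]]"
    obtain W where "\<forall>p\<in>set ?ps. poly p W \<noteq> 0"
      by (rule generic_point[of ?ps]) (use r1 in auto)
    thus ?thesis by (intro I[of 1 W]) (auto simp: mult_ac add.commute)
  qed
  ultimately show ?thesis using A by auto
qed

section \<open>Inclusion of the polynomial patterns in \<open>C_fam 0\<close>\<close>

text \<open>Without \<open>d 2\<close>, \<open>d 3\<close>, \<open>d 4\<close> the function is a
  combination of \<open>M^2\<close> and \<open>M\<close> for \<open>M = n*(n*r-2*r+1)\<close>; its
  factorisation is matched with the three factors of \<open>alpha_zero\<close>.\<close>

lemma C_sub_to_C_fam_zero:
  assumes r: "r \<notin> {0, 1, 1/2, 1/3}" and f: "f \<in> C_sub r A" and A: "A \<subseteq> {0,1}" "A \<noteq> {}"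
  shows "f \<in> C_fam 0"
proof -
  from f obtain d where d: "pf_decomp r f d" "\<And>k. k \<in> {0..4} \<Longrightarrow> d k \<noteq> 0 \<longleftrightarrow> k \<in> A"
    unfolding C_sub_def by auto
  have r0: "r \<noteq> 0" using r by auto
  have d234: "d 2 = 0" "d 3 = 0" "d 4 = 0" using d(2)[of 2] d(2)[of 3] d(2)[of 4] A by auto
  define M :: "complex poly" where "M = [:0,1:] * ([:0,1:]*[:r:] - 2 * [:r:] + 1)"
  have pM: "poly M x = x * (x*r - 2*r + 1)" for x by (simp add: M_def)
  define R where "R = [:1/(256*r^6):] * ([:d 0:] * (16 * [:r:]^4 * M^2) + [:d 1:] * (4 * [:r:]^3 * M))"
  have fR: "f = to_fract R"
    using d(1) unfolding pf_decomp_def R_def M_def to_fract_add to_fract_diff to_fract_mult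
      to_fract_power to_fract_numeral to_fract_1 rconst_def[symmetric] nvar_def[symmetric]
    by (simp add: sum_0_to_4 y_fun_simps d234 rconst_hom power_mult_distrib mult_ac)
  \<comment> \<open>Membership in \<open>C_fam 0\<close> demands a nonzero polynomial; this comes
    from uniqueness of the decomposition and \<open>A \<noteq> {}\<close>.\<close>
  have "f \<noteq> 0"
  proof
    assume "f = 0"
    hence "pf_decomp r f (\<lambda>_. 0)" by (simp add: pf_decomp_def rconst_hom)
    from pf_decomp_unique[OF r d(1) this] d(2) A show False by fastforce
  qed
  hence R0: "R \<noteq> 0" using fR by auto
  have pR: "poly R x = d 0 / (16*r^2) * poly M x^2 + d 1 / (64*r^3) * poly M x" for x
    using r0 by (simp add: R_def field_simps eval_nat_numeral)
  have "\<exists>v. alpha_zero v = R"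
  proof (cases "d 0 = 0")
    case True
    define c where "c = d 1 / (64*r^3)"
    \<comment> \<open>The middle factor of \<open>alpha_zero v\<close> becomes \<open>1\<close> and
      the last one \<open>c*(n*r-2*r+1)\<close>, with product \<open>c*M\<close>.\<close>
    define v where "v = \<lparr>b0 = c*(1-r), b1 = c*r - 1, b2 = 0, s1 = 0, s2 = 1\<rparr>"
    have "poly (alpha_zero v) x = poly R x" for x
      unfolding pR pM True c_def[symmetric]
      by (simp add: alpha_zero_def v_def Let_def) algebra
    thus ?thesis by (metis poly_eq_poly_eq_iff ext)
  next
    case False
    define t where "t = csqrt (d 0) / (4*r)"
    define c where "c = d 1 / (4*r*d 0)"
    have t: "d 0 / (16*r^2) = t^2" by (simp add: t_def power_divide power_mult_distrib)
    have c: "d 1 / (64*r^3) = t^2*c"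
      unfolding t[symmetric] c_def using r0 False by (simp add: field_simps eval_nat_numeral)
    \<comment> \<open>The target is \<open>t^2*M*(M+c)\<close>: the middle factor of
      \<open>alpha_zero v\<close> becomes \<open>t*(n*r-2*r+1)\<close> and the last one
      \<open>t*(M+c)\<close>.\<close>
    define v where "v = \<lparr>b0 = t*(1-r) + t*c, b1 = 2*r*t, b2 = r*t, s1 = 0, s2 = (1-r)*t\<rparr>"
    have "poly (alpha_zero v) x = poly R x" for x
      unfolding pR pM t c
      by (simp add: alpha_zero_def v_def Let_def) algebra
    thus ?thesis by (metis poly_eq_poly_eq_iff ext)
  qed
  thus ?thesis using fR R0 unfolding C_fam_def by auto
qed

section \<open>Disjointness and the excluded patterns\<close>

lemma C_sub_disjoint:
  assumes "r \<notin> {0, 1, 1/2, 1/3}" "A \<subseteq> {0..4}" "B \<subseteq> {0..4}" "A \<noteq> B"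
  shows "C_sub r A \<inter> C_sub r B = {}"
proof (rule ccontr)
  assume "C_sub r A \<inter> C_sub r B \<noteq> {}"
  then obtain f d d' where f: "pf_decomp r f d" "\<forall>k\<in>{0..4}. d k \<noteq> 0 \<longleftrightarrow> k \<in> A"
    "pf_decomp r f d'" "\<forall>k\<in>{0..4}. d' k \<noteq> 0 \<longleftrightarrow> k \<in> B" unfolding C_sub_def by auto
  have "k \<in> A \<longleftrightarrow> k \<in> B" if "k \<in> {0..4}" for k
    using f pf_decomp_unique[OF assms(1) f(1,3) that] that by metis
  thus False using assms by blast
qed

text \<open>By uniqueness any admissible \<open>d\<close> agrees with \<open>d_coeff v r\<close>, so
  \<open>d 4 = d 2 + d 3\<close>, and these three cannot have exactly one nonzero member.\<close>

lemma C_sub_pattern: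
  assumes r: "r \<notin> {0, 1, 1/2, 1/3}" and "C_sub r A \<noteq> {}"
  shows "2 \<in> A \<Longrightarrow> 3 \<in> A \<or> 4 \<in> A" "3 \<in> A \<Longrightarrow> 2 \<in> A \<or> 4 \<in> A" "4 \<in> A \<Longrightarrow> 2 \<in> A \<or> 3 \<in> A"
proof -
  have r0: "r \<noteq> 0" using r by auto
  obtain v d where d: "pf_decomp r (alpha v r) d" "\<forall>k\<in>{0..4}. d k \<noteq> 0 \<longleftrightarrow> k \<in> A"
    using assms(2) r0 unfolding C_sub_def C_fam_def by auto
  have "d_coeff v r k \<noteq> 0 \<longleftrightarrow> k \<in> A" if "k \<in> {0..4}" for k
    using d pf_decomp_unique[OF r d(1) alpha_decomp[OF r0] that] that by metis
  from this[of 2] this[of 3] this[of 4]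
  show "2 \<in> A \<Longrightarrow> 3 \<in> A \<or> 4 \<in> A" "3 \<in> A \<Longrightarrow> 2 \<in> A \<or> 4 \<in> A" "4 \<in> A \<Longrightarrow> 2 \<in> A \<or> 3 \<in> A"
    by (auto simp: d_coeff_def)
qed

section \<open>Enumeration and count of the patterns\<close>

theorem mainTheorem1:
  fixes r :: complex
  assumes "r \<notin> {0, 1, 1/2, 1/3}"
    and "\<And>m::nat. m > 0 \<Longrightarrow> r \<noteq> - 1 / of_nat m"
  shows "(\<forall>A B. A \<subseteq> {0..4} \<and> A \<noteq> {} \<and> B \<subseteq> {0..4} \<and> B \<noteq> {} \<and> A \<noteq> B
            \<longrightarrow> C_sub r A \<inter> C_sub r B = {})
    \<and> card {A. A \<subseteq> {0..4} \<and> A \<noteq> {} \<and> C_sub r A \<noteq> {}} = 19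
    \<and> {A. A \<subseteq> {0..4} \<and> A \<noteq> {} \<and> C_sub r A \<noteq> {}} =
        {{0,1,2,3,4},
         {1,2,3,4}, {0,2,3,4}, {0,1,3,4}, {0,1,2,4}, {0,1,2,3},
         {2,3,4}, {1,3,4}, {1,2,4}, {1,2,3}, {0,3,4}, {0,2,4}, {0,2,3},
         {3,4}, {2,4}, {2,3}, {0,1}, {0}, {1}}
    \<and> C_sub r {0} \<union> C_sub r {1} \<union> C_sub r {0,1} \<subseteq> C_fam 0"
proof -
  let ?L = "{{0,1,2,3,4},
         {1,2,3,4}, {0,2,3,4}, {0,1,3,4}, {0,1,2,4}, {0,1,2,3},
         {2,3,4}, {1,3,4}, {1,2,4}, {1,2,3}, {0,3,4}, {0,2,4}, {0,2,3},
         {3,4}, {2,4}, {2,3}, {0,1}, {0}, {1}} :: nat set set"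
  note r = assms(1)
  \<comment> \<open>The instance \<open>m = 1\<close> of the second assumption gives
    \<open>r \<noteq> -1\<close>.\<close>
  have r1: "r \<noteq> 0" "r \<noteq> 1" "r \<noteq> -1" "r \<notin> {0, 1, 1/3}" using r assms(2)[of 1] by auto
  have disj: "C_sub r A \<inter> C_sub r B = {}" if "A \<subseteq> {0..4}" "B \<subseteq> {0..4}" "A \<noteq> B" for A B
    using C_sub_disjoint[OF r] that by blast
  have eq: "{A. A \<subseteq> {0..4} \<and> A \<noteq> {} \<and> C_sub r A \<noteq> {}} = ?L" (is "?S = _")
  proof
    show "?S \<subseteq> ?L"
    proof
      fix A assume "A \<in> ?S"
      let ?set = "\<lambda>a b c d e. (if e then {4::nat} else {}) \<union> (if d then {3} else {}) \<union>
        (if c then {2} else {}) \<union> (if b then {1} else {}) \<union> (if a then {0} else {})"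
      from \<open>A \<in> ?S\<close> have A: "A \<subseteq> {0..4}" "A \<noteq> {}" "C_sub r A \<noteq> {}" by auto
      \<comment> \<open>A subset of \<open>{0..4}\<close> is encoded by five membership bits, which
        makes the classification a finite check of 32 cases.\<close>
      have pat: "?set a b c d e \<in> ?L"
        if "a \<or> b \<or> c \<or> d \<or> e" "c \<Longrightarrow> d \<or> e" "d \<Longrightarrow> c \<or> e" "e \<Longrightarrow> c \<or> d" for a b c d e
        using that by (cases a; cases b; cases c; cases d; cases e; simp)
      have "k \<in> A \<longleftrightarrow> k \<in> ?set (0 \<in> A) (1 \<in> A) (2 \<in> A) (3 \<in> A) (4 \<in> A)" for k
      proof (cases "k \<in> {0,1,2,3,4}")
        case True thus ?thesis by auto
      next
        case False
        hence "\<not> k \<le> 4" by auto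
        thus ?thesis using A(1) False by auto
      qed
      hence "A = ?set (0 \<in> A) (1 \<in> A) (2 \<in> A) (3 \<in> A) (4 \<in> A)" by (rule set_eqI)
      moreover have "0 \<in> A \<or> 1 \<in> A \<or> 2 \<in> A \<or> 3 \<in> A \<or> 4 \<in> A"
        using A(2) calculation by (auto split: if_splits)
      ultimately show "A \<in> ?L" using pat C_sub_pattern[OF r A(3)] by metis
    qed
    show "?L \<subseteq> ?S"
    proof
      fix A assume A: "A \<in> ?L"
      have "A \<in> {{1,2,3,4}, {2,3,4}, {1,3,4}, {1,2,4}, {1,2,3}, {3,4}, {2,4}, {2,3}, {1}}
        \<or> A \<in> {{0,1,2,3,4}, {0,1,3,4}, {0,1,2,4}, {0,1,2,3}, {0,1}}
        \<or> A \<in> {{0,2,3,4}, {0,3,4}, {0,2,4}, {0,2,3}, {0}}"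
        using A by (simp only: insert_iff empty_iff simp_thms disj_ac)
      hence "C_sub r A \<noteq> {}"
        using C_sub_nonempty_b2_zero[OF r1(1-3)] C_sub_nonempty_b2_one_generic[OF r1(4,3)]
          C_sub_nonempty_b2_one_p1_zero[OF r1(4,3)] by metis
      moreover have "A \<subseteq> {0..4} \<and> A \<noteq> {}" using A by auto
      ultimately show "A \<in> ?S" by blast
    qed
  qed
  have card: "card ?L = 19"
  proof (rule antisym)
    show "card ?L \<le> 19" by (intro card_insert_le_m1) simp_all
    \<comment> \<open>Binary encoding sends the listed sets to 19 distinct integers, which bounds
      the cardinality from below.\<close>
    have "(\<lambda>A. \<Sum>k\<in>A. 2^k) ` ?L =
        {31, 30, 29, 27, 23, 15, 28, 26, 22, 14, 25, 21, 13, 24, 20, 12, 3, 1, 2::int}"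
      by (simp add: insert_commute)
    hence "card ((\<lambda>A. \<Sum>k\<in>A. 2^k :: int) ` ?L) = 19" by simp
    thus "19 \<le> card ?L" using card_image_le[of ?L "\<lambda>A. \<Sum>k\<in>A. 2^k :: int"] by simp
  qed
  have "C_sub r {0} \<union> C_sub r {1} \<union> C_sub r {0,1} \<subseteq> C_fam 0"
    using C_sub_to_C_fam_zero[OF r] by blast
  thus ?thesis unfolding eq using disj card by blast
qed

end
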